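(* Let $Y$ be a vertex algebra structure on the chiral boson. Given finite sets $S_1,S_2\subset\mathbb P\setminus P$, states $\mathtt v_1\in{}_{S_1}\mathbf W$, $\mathtt v_2\in{}_{S_2}\mathbf W$ and translations $v_1,v_2$ with $(S_1+v_1)\cap(S_2+v_2)=\emptyset$, one has $$Y(\mathtt v_1,v_1)\circ Y(\mathtt v_2,v_2)=Y\bigl(Y(\mathtt v_1,v_1-v_2)\mathtt v_2,\ v_2\bigr)$$ on $\mathbf W^{(S_1+v_1)\cup(S_2+v_2)}$.
   Context: Fix a point $P$ of a complex projective line $\mathbb P$. Translations are the automorphisms in the additive group ($\cong\mathbb C$) of translations of the affine line $\mathbb P\setminus P$; $z+v$ is the action of $v$ on $z$; in a coordinate $u$ with pole at $P$, $u(z+v)=u(z)+u(v)$. $\mathbf K$ is the space of meromorphic 1-forms on $\mathbb P$ with all residues zero, regular at $P$; $\mathbf W=S^*\mathbf K$, vacuum $\mathbf 1$. For a finite set $S\subset\mathbb P\setminus P$: ${}_S\mathbf W=S^*({}_S\mathbf K)$ with ${}_S\mathbf K\subset\mathbf K$ the forms with all poles in $S$; $\mathbf W^S=S^*(\mathbf K^S)$ with $\mathbf K^S\subset\mathbf K$ the forms regular at every point of $S$. $\mathsf T_v:\mathbf W\to\mathbf W$ is induced by $a(u)du\mapsto a(u-u(v))du$ and maps ${}_S\mathbf W$ to ${}_{S+v}\mathbf W$. For $O\ne P$ and $\lambda\in\mathbb C^*=\mathrm{Aut}_{O,P}(\mathbb P)$ acting by $u(\lambda(z))=\lambda u(z)$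 (with $u(O)=0$, $u(P)=\infty$), $\mathsf R_\lambda$ is the operator on $\mathbf W$ induced by pull-back by $\lambda^{-1}$. A vertex algebra structure on the chiral boson is an assignment, linear in the state, to each finite set $S$, state $\mathtt v\in{}_S\mathbf W$ and translation $v$ of an operator $Y(\mathtt v,v):\mathbf W^{S+v}\to\mathbf W$ (compatible with enlarging $S$), such that: 1. if $\mathtt v'\in{}_{S'}\mathbf W\cap\mathbf W^{S+v}$ then $Y(\mathtt v,v)\mathtt v'\in{}_{S'\cup(S+v)}\mathbf W$; 2. $Y(\mathbf 1,v)=\mathrm{Id}$; 3. $Y(\mathtt v,0)\mathbf 1=\mathtt v$; 4. for $\mathtt v\in{}_S\mathbf W$, $\mathtt v'\in{}_{S'}\mathbf W$, the operators $Y(\mathtt v,v)$ and $Y(\mathtt v',v')$ commute if $S+v$ is disjoint from $S'+v'$ (where both compositions are defined); 5. $Y(\mathtt v,v+v')=\mathsf T_{v'}\circ Y(\mathtt v,v)\circ\mathsf T_{-v'}$ for translations $v,v'$; 6. $Y$ is $\mathrm{Aut}_P(\mathbb P)$-covariant: $Y(\mathsf T_{v'}\mathtt v,v)=\mathsf T_{v'}Y(\mathtt v,v)\mathsf T_{-v'}$ and $Y(\mathsf R_\lambda\mathtt v,\lambda v)=\mathsf R_\lambda Y(\mathtt v,v)\mathsf R_{\lambda^{-1}}$ for rotations $\lambda$ about any point $O$; 7. for a fixed point $O$, the vectors $Y(\mathtt v_n,v_n)\cdots Y(\mathtt v_1,v_1)\mathbf 1$, over all sequences of distinct translations $v_i$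 and states $\mathtt v_i\in{}_{\{O\}}\mathbf W$, span $\mathbf W$. *)

theory Defs
  imports "HOL-Complex_Analysis.Complex_Analysis" "HOL-Library.Poly_Mapping"
begin

section \<open>Complex vector spaces and commutative algebras\<close>

class complex_vector = ab_group_add +
  fixes cscale :: "complex \<Rightarrow> 'a \<Rightarrow> 'a"  (infixr \<open>*\<^sub>C\<close> 75)
  assumes cscale_right_distrib: "c *\<^sub>C (x + y) = c *\<^sub>C x + c *\<^sub>C y"
    and cscale_left_distrib: "(c + d) *\<^sub>C x = c *\<^sub>C x + d *\<^sub>C x"
    and cscale_cscale: "c *\<^sub>C (d *\<^sub>C x) = (c * d) *\<^sub>C x"
    and cscale_one: "1 *\<^sub>C x = x"

global_interpretation cvec: vector_space "cscale :: complex \<Rightarrow> 'a \<Rightarrow> 'a::complex_vector"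
  by unfold_locales
    (rule cscale_right_distrib cscale_left_distrib cscale_cscale cscale_one)+

abbreviation clinear :: "('a::complex_vector \<Rightarrow> 'b::complex_vector) \<Rightarrow> bool"
  where "clinear \<equiv> Vector_Spaces.linear cscale cscale"

class comm_complex_algebra = comm_ring_1 + complex_vector +
  assumes cscale_mult_left: "(c *\<^sub>C x) * y = c *\<^sub>C (x * y)"
begin
lemma cscale_mult_right: "x * (c *\<^sub>C y) = c *\<^sub>C (x * y)"
  using cscale_mult_left[of c y x] by (simp add: mult.commute)
end

instantiation complex :: comm_complex_algebra
begin
definition cscale_complex :: "complex \<Rightarrow> complex \<Rightarrow> complex" where "cscale_complex = (*)"
instance by standard (simp_all add: cscale_complex_def algebra_simps)
end

definition calg_hom :: "('a::comm_complex_algebra \<Rightarrow> 'b::comm_complex_algebra) \<Rightarrow> bool" where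
  "calg_hom h \<longleftrightarrow> h 1 = 1 \<and> (\<forall>x y. h (x + y) = h x + h y) \<and> (\<forall>x y. h (x * y) = h x * h y)
     \<and> (\<forall>c x. h (c *\<^sub>C x) = c *\<^sub>C h x)"

section \<open>The symmetric algebra of a complex vector space\<close>

text \<open>
  The symmetric algebra is the polynomial ring with one indeterminate \<open>pvar v\<close> for each vector
  \<open>v\<close>, modulo the ideal generated by the linear relations between vectors.  Its universal
  property is proved below (\<open>calg_hom_sym_lift\<close>, \<open>sym_lift_sym_of\<close>, \<open>sym_lift_unique\<close>).
\<close>

type_synonym 'v pring = "('v \<Rightarrow>\<^sub>0 nat) \<Rightarrow>\<^sub>0 complex"

definition pvar :: "'v \<Rightarrow> 'v pring" where
  "pvar v = Poly_Mapping.single (Poly_Mapping.single v 1) 1"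

definition pconst :: "complex \<Rightarrow> 'v pring" where
  "pconst c = Poly_Mapping.single 0 c"

inductive_set sym_ideal :: "'v::complex_vector pring set" where
  add_rel: "pvar (u + v) - pvar u - pvar v \<in> sym_ideal"
| scale_rel: "pvar (c *\<^sub>C v) - pconst c * pvar v \<in> sym_ideal"
| add: "p \<in> sym_ideal \<Longrightarrow> q \<in> sym_ideal \<Longrightarrow> p + q \<in> sym_ideal"
| mult: "p \<in> sym_ideal \<Longrightarrow> q * p \<in> sym_ideal"

lemma sym_ideal_0: "0 \<in> sym_ideal"
  using sym_ideal.mult[OF sym_ideal.add_rel, of 0] by simp

lemma sym_ideal_minus: "p \<in> sym_ideal \<Longrightarrow> - p \<in> sym_ideal"
  using sym_ideal.mult[of p "-1"] by simp

lemma sym_ideal_diff: "p \<in> sym_ideal \<Longrightarrow> q \<in> sym_ideal \<Longrightarrow> p - q \<in> sym_ideal"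
  using sym_ideal.add[of p "- q"] sym_ideal_minus by auto

quotient_type (overloaded) 'v sym =
  "'v::complex_vector pring" / "\<lambda>p q. p - q \<in> sym_ideal"
proof (rule equivpI)
  show "reflp (\<lambda>p q::'v pring. p - q \<in> sym_ideal)"
    by (auto intro!: reflpI sym_ideal_0)
  show "symp (\<lambda>p q::'v pring. p - q \<in> sym_ideal)"
  proof (rule sympI)
    fix p q :: "'v pring" assume "p - q \<in> sym_ideal"
    from sym_ideal_minus[OF this] show "q - p \<in> sym_ideal" by simp
  qed
  show "transp (\<lambda>p q::'v pring. p - q \<in> sym_ideal)"
  proof (rule transpI)
    fix p q r :: "'v pring" assume "p - q \<in> sym_ideal" "q - r \<in> sym_ideal"
    from sym_ideal.add[OF this] show "p - r \<in> sym_ideal" by simp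
  qed
qed

definition peval :: "('v \<Rightarrow> 'a::comm_complex_algebra) \<Rightarrow> 'v pring \<Rightarrow> 'a" where
  "peval g p = (\<Sum>m\<in>Poly_Mapping.keys p. Poly_Mapping.lookup p m *\<^sub>C
     (\<Prod>v\<in>Poly_Mapping.keys m. g v ^ Poly_Mapping.lookup m v))"

lemma peval_superset:
  assumes "finite A" "Poly_Mapping.keys p \<subseteq> A"
  shows "peval g p = (\<Sum>m\<in>A. Poly_Mapping.lookup p m *\<^sub>C
     (\<Prod>v\<in>Poly_Mapping.keys m. g v ^ Poly_Mapping.lookup m v))"
  unfolding peval_def
  by (rule sum.mono_neutral_left) (use assms in \<open>auto simp: in_keys_iff\<close>)

lemma peval_add: "peval g (p + q) = peval g p + peval g q"
proof -
  let ?A = "Poly_Mapping.keys p \<union> Poly_Mapping.keys q"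
  have "Poly_Mapping.keys (p + q) \<subseteq> ?A" by (rule keys_add)
  thus ?thesis
    by (subst (1 2 3) peval_superset[of ?A])
      (auto simp: lookup_add cscale_left_distrib sum.distrib)
qed

lemma peval_0: "peval g 0 = 0"
  by (simp add: peval_def)

lemma peval_single: "peval g (Poly_Mapping.single m c) =
    c *\<^sub>C (\<Prod>v\<in>Poly_Mapping.keys m. g v ^ Poly_Mapping.lookup m v)"
  by (cases "c = 0") (auto simp: peval_def)

lemma monom_eval_add:
  "(\<Prod>v\<in>Poly_Mapping.keys (m + n). (g v :: 'a::comm_monoid_mult) ^ Poly_Mapping.lookup (m + n) v) =
   (\<Prod>v\<in>Poly_Mapping.keys m. g v ^ Poly_Mapping.lookup m v) *
   (\<Prod>v\<in>Poly_Mapping.keys n. g v ^ Poly_Mapping.lookup n v)"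
proof -
  let ?A = "Poly_Mapping.keys m \<union> Poly_Mapping.keys n"
  have *: "(\<Prod>v\<in>Poly_Mapping.keys k. g v ^ Poly_Mapping.lookup k v) =
      (\<Prod>v\<in>?A. g v ^ Poly_Mapping.lookup k v)" if "Poly_Mapping.keys k \<subseteq> ?A" for k
    by (rule prod.mono_neutral_left) (use that in \<open>auto simp: in_keys_iff\<close>)
  show ?thesis
    using keys_add[of m n]
    by (subst (1 2 3) *) (auto simp: lookup_add power_add prod.distrib)
qed

lemma pring_induct [case_names zero add_single]:
  assumes "P 0" "\<And>p m c. P p \<Longrightarrow> P (p + Poly_Mapping.single m c)"
  shows "P (p :: 'v pring)"
proof (induction p rule: update_induct)
  case const
  show ?case by (rule assms)
next
  case (update f a b)
  have "Poly_Mapping.update a b f = f + Poly_Mapping.single a b"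
    using update(1)
    by (intro poly_mapping_eqI)
      (auto simp: lookup_update lookup_add lookup_single in_keys_iff when_def)
  thus ?case using assms(2)[OF update(3)] by simp
qed

lemma peval_mult_single:
  "peval g (p * Poly_Mapping.single m c) = peval g p * peval g (Poly_Mapping.single m c)"
proof (induction p rule: pring_induct)
  case zero
  show ?case by (simp add: peval_0)
next
  case (add_single p n d)
  show ?case
    by (simp add: distrib_right peval_add add_single mult_single peval_single monom_eval_add
        cscale_mult_left cscale_mult_right cscale_cscale cscale_right_distrib mult.commute[of c d])
qed

lemma peval_mult: "peval g (p * q) = peval g p * peval g q"
proof (induction q rule: pring_induct)
  case zero
  show ?case by (simp add: peval_0)
next
  case (add_single q n d)
  show ?case by (simp add: distrib_left peval_add add_single peval_mult_single)
qed

lemma peval_pconst: "peval g (pconst c) = c *\<^sub>C 1"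
  by (simp add: pconst_def peval_single)

lemma peval_1: "peval g 1 = 1"
  using peval_pconst[of g 1] by (simp add: pconst_def cscale_one)

lemma peval_pvar: "peval g (pvar v) = g v"
  by (simp add: pvar_def peval_single cscale_one)

lemma peval_diff: "peval g (p - q) = peval g p - peval g q"
  using peval_add[of g "p - q" q] by (simp add: algebra_simps)

lemma peval_sym_ideal:
  assumes "p \<in> sym_ideal" "clinear g"
  shows "peval g p = 0"
proof -
  have g: "g (u + v) = g u + g v" "g (c *\<^sub>C v) = c *\<^sub>C g v" for u v c
    using assms(2) by (simp_all add: Vector_Spaces.linear.axioms
        vector_space_pair.linear_add vector_space_pair.linear_scale
        linear_iff_module_hom module_hom_iff)
  from assms(1) show ?thesis
    by induction (auto simp: peval_add peval_mult peval_diff peval_pvar peval_pconst g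
        cscale_mult_left)
qed

lemma clinear_0: "clinear (\<lambda>_. 0)"
  by (simp add: linear_iff_module_hom module_hom_iff cvec.module_axioms)

lemma one_notin_sym_ideal: "1 \<notin> (sym_ideal :: 'v::complex_vector pring set)"
proof
  assume "1 \<in> (sym_ideal :: 'v pring set)"
  from peval_sym_ideal[OF this, of "\<lambda>_. 0 :: complex"] show False
    by (simp add: clinear_0 peval_1)
qed

instantiation sym :: (complex_vector) comm_complex_algebra
begin

lift_definition zero_sym :: "'a sym" is 0 .
lift_definition one_sym :: "'a sym" is 1 .
lift_definition plus_sym :: "'a sym \<Rightarrow> 'a sym \<Rightarrow> 'a sym" is "(+)"
proof -
  fix p p' q q' :: "'a pring"
  assume "p - p' \<in> sym_ideal" "q - q' \<in> sym_ideal"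
  from sym_ideal.add[OF this] show "p + q - (p' + q') \<in> sym_ideal" by (simp add: algebra_simps)
qed
lift_definition uminus_sym :: "'a sym \<Rightarrow> 'a sym" is uminus
proof -
  fix p p' :: "'a pring"
  assume "p - p' \<in> sym_ideal"
  from sym_ideal_minus[OF this] show "- p - - p' \<in> sym_ideal" by (simp add: algebra_simps)
qed
lift_definition minus_sym :: "'a sym \<Rightarrow> 'a sym \<Rightarrow> 'a sym" is "(-)"
proof -
  fix p p' q q' :: "'a pring"
  assume "p - p' \<in> sym_ideal" "q - q' \<in> sym_ideal"
  from sym_ideal_diff[OF this] show "p - q - (p' - q') \<in> sym_ideal" by (simp add: algebra_simps)
qed
lift_definition times_sym :: "'a sym \<Rightarrow> 'a sym \<Rightarrow> 'a sym" is "(*)"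
proof -
  fix p p' q q' :: "'a pring"
  assume "p - p' \<in> sym_ideal" "q - q' \<in> sym_ideal"
  hence "q * (p - p') + p' * (q - q') \<in> sym_ideal"
    by (intro sym_ideal.add sym_ideal.mult)
  thus "p * q - p' * q' \<in> sym_ideal" by (simp add: algebra_simps)
qed
lift_definition cscale_sym :: "complex \<Rightarrow> 'a sym \<Rightarrow> 'a sym" is "\<lambda>c p. pconst c * p"
  by (subst right_diff_distrib[symmetric]) (rule sym_ideal.mult)

instance
proof
  fix x y z :: "'a sym" and c d :: complex
  obtain p where x: "x = abs_sym p" by (rule that[OF Quotient_abs_rep[OF Quotient_sym, symmetric]])
  obtain q where y: "y = abs_sym q" by (rule that[OF Quotient_abs_rep[OF Quotient_sym, symmetric]])
  obtain r where z: "z = abs_sym r" by (rule that[OF Quotient_abs_rep[OF Quotient_sym, symmetric]])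
  note abs = x y z zero_sym_def one_sym_def plus_sym.abs_eq uminus_sym.abs_eq minus_sym.abs_eq
    times_sym.abs_eq cscale_sym.abs_eq
  show "x + y + z = x + (y + z)" by (simp only: abs add.assoc)
  show "x + y = y + x" by (simp only: abs add.commute)
  show "0 + x = x" by (simp only: abs add_0_left)
  show "- x + x = 0" by (simp only: abs left_minus)
  show "x - y = x + - y" by (simp only: abs diff_conv_add_uminus)
  show "x * y * z = x * (y * z)" by (simp only: abs mult.assoc)
  show "x * y = y * x" by (simp only: abs mult.commute)
  show "1 * x = x" by (simp only: abs mult_1_left)
  show "(x + y) * z = x * z + y * z" by (simp only: abs distrib_right)
  show "(0::'a sym) \<noteq> 1"
  proof
    assume "(0::'a sym) = 1"
    hence "abs_sym 0 = (abs_sym 1 :: 'a sym)" by (simp only: zero_sym_def one_sym_def)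
    hence "0 - 1 \<in> (sym_ideal :: 'a pring set)" by (rule sym.abs_eq_iff[THEN iffD1])
    from sym_ideal_minus[OF this] show False by (simp add: one_notin_sym_ideal)
  qed
  show "c *\<^sub>C (x + y) = c *\<^sub>C x + c *\<^sub>C y" by (simp only: abs distrib_left)
  show "(c + d) *\<^sub>C x = c *\<^sub>C x + d *\<^sub>C x"
    by (simp only: abs pconst_def single_add distrib_right)
  show "c *\<^sub>C (d *\<^sub>C x) = (c * d) *\<^sub>C x"
    by (simp only: abs pconst_def mult.assoc[symmetric] mult_single add_0_left)
  show "1 *\<^sub>C x = x" by (simp only: abs pconst_def single_one mult_1_left)
  show "(c *\<^sub>C x) * y = c *\<^sub>C (x * y)" by (simp only: abs mult.assoc)
qed

end

lift_definition sym_of :: "'v::complex_vector \<Rightarrow> 'v sym" is pvar .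

lemma clinear_sym_of: "clinear sym_of"
proof -
  have "sym_of (u + v) = sym_of u + sym_of v" for u v :: 'a
    by transfer (simp add: diff_diff_add[symmetric] sym_ideal.add_rel)
  moreover have "sym_of (c *\<^sub>C v) = c *\<^sub>C sym_of v" for c and v :: 'a
    by transfer (rule sym_ideal.scale_rel)
  ultimately show ?thesis
    by (simp add: linear_iff_module_hom module_hom_iff cvec.module_axioms)
qed

definition sym_lift :: "('v::complex_vector \<Rightarrow> 'a::comm_complex_algebra) \<Rightarrow> 'v sym \<Rightarrow> 'a" where
  "sym_lift g x = peval g (rep_sym x)"

lemma sym_lift_abs:
  assumes "clinear g"
  shows "sym_lift g (abs_sym p) = peval g p"
proof -
  have "rep_sym (abs_sym p) - p \<in> sym_ideal"
    using Quotient_rep_abs[OF Quotient_sym, of p] by (simp add: sym_ideal_0)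
  from peval_sym_ideal[OF this assms] show ?thesis
    by (simp add: sym_lift_def peval_diff)
qed

lemma sym_abs_cases: obtains p where "x = abs_sym p"
  by (rule that[OF Quotient_abs_rep[OF Quotient_sym, symmetric]])

lemma calg_hom_sym_lift:
  fixes g :: "'v::complex_vector \<Rightarrow> 'a::comm_complex_algebra"
  assumes g: "clinear g"
  shows "calg_hom (sym_lift g)"
  unfolding calg_hom_def
proof (intro conjI allI)
  fix x y :: "'v sym" and c
  obtain p where "x = abs_sym p" by (rule sym_abs_cases)
  moreover obtain q where "y = abs_sym q" by (rule sym_abs_cases)
  ultimately have xy: "x = abs_sym p" "y = abs_sym q" by simp_all
  show "sym_lift g 1 = 1" by (simp add: one_sym_def sym_lift_abs g peval_1)
  show "sym_lift g (x + y) = sym_lift g x + sym_lift g y"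
    by (simp add: xy plus_sym.abs_eq sym_lift_abs g peval_add)
  show "sym_lift g (x * y) = sym_lift g x * sym_lift g y"
    by (simp add: xy times_sym.abs_eq sym_lift_abs g peval_mult)
  show "sym_lift g (c *\<^sub>C x) = c *\<^sub>C sym_lift g x"
    by (simp add: xy cscale_sym.abs_eq sym_lift_abs g peval_mult peval_pconst cscale_mult_left)
qed

lemma sym_lift_sym_of: "clinear g \<Longrightarrow> sym_lift g (sym_of v) = g v"
  by (simp add: sym_of.abs_eq sym_lift_abs peval_pvar)

text \<open>\<open>symalg U\<close> is \<open>S\<^sup>*(U)\<close> for a linear subspace \<open>U\<close> of \<open>V\<close>, as a subalgebra of \<open>S\<^sup>*(V)\<close>.\<close>

inductive_set symalg :: "'v::complex_vector set \<Rightarrow> 'v sym set" for U where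
  symalg_of: "u \<in> U \<Longrightarrow> sym_of u \<in> symalg U"
| symalg_one: "1 \<in> symalg U"
| symalg_scale: "x \<in> symalg U \<Longrightarrow> c *\<^sub>C x \<in> symalg U"
| symalg_add: "x \<in> symalg U \<Longrightarrow> y \<in> symalg U \<Longrightarrow> x + y \<in> symalg U"
| symalg_mult: "x \<in> symalg U \<Longrightarrow> y \<in> symalg U \<Longrightarrow> x * y \<in> symalg U"

lemma symalg_UNIV: "symalg UNIV = UNIV"
proof -
  have pw: "x ^ n \<in> symalg UNIV" if "x \<in> symalg UNIV" for x :: "'a sym" and n
    by (induction n) (auto intro: symalg.intros that)
  have mon: "abs_sym (Poly_Mapping.single m 1) \<in> symalg UNIV" for m :: "'a \<Rightarrow>\<^sub>0 nat"
  proof (induction m rule: update_induct)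
    case const
    show ?case using symalg_one by (simp add: one_sym_def)
  next
    case (update m v n)
    have "abs_sym (Poly_Mapping.single (Poly_Mapping.single v n) 1) \<in> symalg UNIV"
    proof (induction n)
      case 0
      show ?case using symalg_one by (simp add: one_sym_def)
    next
      case (Suc n)
      have "Poly_Mapping.single (Poly_Mapping.single v (Suc n)) 1 =
          pvar v * (Poly_Mapping.single (Poly_Mapping.single v n) 1 :: 'a pring)"
        by (simp add: pvar_def mult_single single_add[symmetric])
      hence "abs_sym (Poly_Mapping.single (Poly_Mapping.single v (Suc n)) 1) =
          sym_of v * abs_sym (Poly_Mapping.single (Poly_Mapping.single v n) 1)"
        by (simp add: sym_of.abs_eq times_sym.abs_eq)
      thus ?case using Suc by (auto intro: symalg.intros)
    qed
    moreover have "Poly_Mapping.update v n m = m + Poly_Mapping.single v n"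
      using update(1) by (intro poly_mapping_eqI)
        (auto simp: lookup_update lookup_add lookup_single in_keys_iff when_def)
    hence "abs_sym (Poly_Mapping.single (Poly_Mapping.update v n m) 1) =
        abs_sym (Poly_Mapping.single m 1) * abs_sym (Poly_Mapping.single (Poly_Mapping.single v n) 1)"
      by (simp add: times_sym.abs_eq mult_single)
    ultimately show ?case using update(3) by (auto intro: symalg.intros)
  qed
  have "abs_sym p \<in> symalg UNIV" for p :: "'a pring"
  proof (induction p rule: pring_induct)
    case zero
    have "abs_sym 0 = 0 *\<^sub>C (1 :: 'a sym)" by (simp add: zero_sym_def[symmetric])
    thus ?case using symalg_scale[OF symalg_one, of 0] by simp
  next
    case (add_single p m c)
    have "abs_sym (p + Poly_Mapping.single m c) = abs_sym p + c *\<^sub>C abs_sym (Poly_Mapping.single m 1)"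
      by (simp add: plus_sym.abs_eq cscale_sym.abs_eq pconst_def mult_single)
    thus ?case using add_single mon[of m] by (auto intro: symalg.intros)
  qed
  hence "x \<in> symalg UNIV" for x :: "'a sym" by (cases x rule: sym_abs_cases) simp
  thus ?thesis by blast
qed

lemma sym_lift_unique:
  fixes h :: "'v::complex_vector sym \<Rightarrow> 'a::comm_complex_algebra"
  assumes "calg_hom h" "clinear g" "\<And>v. h (sym_of v) = g v"
  shows "h = sym_lift g"
proof
  fix x :: "'v sym"
  have "x \<in> symalg UNIV" by (simp add: symalg_UNIV)
  thus "h x = sym_lift g x"
    using assms(1) calg_hom_sym_lift[OF assms(2)]
    by induction (auto simp: calg_hom_def assms(2,3) sym_lift_sym_of)
qed

definition sym_map :: "('v::complex_vector \<Rightarrow> 'w::complex_vector) \<Rightarrow> 'v sym \<Rightarrow> 'w sym" where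
  "sym_map \<phi> = sym_lift (sym_of \<circ> \<phi>)"

lemma calg_hom_sym_map: "clinear \<phi> \<Longrightarrow> calg_hom (sym_map \<phi>)"
  unfolding sym_map_def
  by (intro calg_hom_sym_lift Vector_Spaces.linear_compose[OF _ clinear_sym_of])

lemma sym_map_sym_of: "clinear \<phi> \<Longrightarrow> sym_map \<phi> (sym_of v) = sym_of (\<phi> v)"
  unfolding sym_map_def
  by (simp add: sym_lift_sym_of Vector_Spaces.linear_compose[OF _ clinear_sym_of])

lemma sym_map_symalg:
  assumes "clinear \<phi>" "x \<in> symalg U" "\<phi> ` U \<subseteq> U'"
  shows "sym_map \<phi> x \<in> symalg U'"
  using assms(2) calg_hom_sym_map[OF assms(1)]
  by induction (use assms in \<open>auto simp: calg_hom_def sym_map_sym_of intro: symalg.intros\<close>)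

section \<open>Forms on the projective line\<close>

text \<open>
  An affine coordinate \<open>u\<close> with pole at \<open>P\<close> identifies the affine line \<open>\<bbbP> - P\<close>, as well as its
  group of translations, with \<^typ>\<open>complex\<close>; the translation \<open>v\<close> acts by \<open>z \<mapsto> z + v\<close>.  A meromorphic
  1-form \<open>f(u) du\<close> is represented by its coefficient \<open>f\<close>, normalised at the removable
  singularities and poles by \<^const>\<open>nicely_meromorphic_on\<close>, so that equal forms are equal functions.
\<close>

text \<open>In the coordinate \<open>w = 1/u\<close> at \<open>P\<close>, the form \<open>f(u) du\<close> is \<open>-f(1/w)/w\<^sup>2 dw\<close>.\<close>

definition regular_at_P :: "(complex \<Rightarrow> complex) \<Rightarrow> bool" where
  "regular_at_P f \<longleftrightarrow> (\<exists>g. g analytic_on {0} \<and> (\<forall>\<^sub>F w in at 0. g w = - f (1 / w) / w\<^sup>2))"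

definition K_form :: "(complex \<Rightarrow> complex) \<Rightarrow> bool" where
  "K_form f \<longleftrightarrow> f nicely_meromorphic_on UNIV \<and> (\<forall>z. residue f z = 0) \<and> regular_at_P f"

text \<open>
  The residue at \<open>P\<close> vanishes because the form is regular there; regularity at \<open>P\<close> also
  gives meromorphy there.
\<close>

lemma nicely_meromorphic_eqI:
  assumes "f nicely_meromorphic_on UNIV" "g nicely_meromorphic_on UNIV"
    and "\<And>z. \<forall>\<^sub>F w in at z. f w = g w"
  shows "f = g"
proof
  fix z
  have f: "is_pole f z \<and> f z = 0 \<or> f \<midarrow>z\<rightarrow> f z" and g: "is_pole g z \<and> g z = 0 \<or> g \<midarrow>z\<rightarrow> g z"
    using assms(1,2) by (auto simp: nicely_meromorphic_on_def)
  have p: "is_pole f z \<longleftrightarrow> is_pole g z" by (rule is_pole_cong[OF assms(3) refl])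
  show "f z = g z"
  proof (cases "is_pole f z")
    case True
    with p have "is_pole g z" by simp
    moreover have "\<not> h \<midarrow>z\<rightarrow> h z" if "is_pole h z" for h :: "complex \<Rightarrow> complex"
      using that unfolding is_pole_def
      by (meson at_neq_bot not_tendsto_and_filterlim_at_infinity)
    ultimately show ?thesis using True f g by auto
  next
    case False
    hence "f \<midarrow>z\<rightarrow> f z" "g \<midarrow>z\<rightarrow> g z" using p f g by auto
    moreover have "g \<midarrow>z\<rightarrow> f z"
      using \<open>f \<midarrow>z\<rightarrow> f z\<close> tendsto_cong[OF assms(3)] by blast
    ultimately show ?thesis using LIM_unique by blast
  qed
qed

lemma mero_isolated: "f meromorphic_on UNIV \<Longrightarrow> isolated_singularity_at f z"
  by (rule meromorphic_on_isolated_singularity) (rule meromorphic_on_subset, auto)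

lemma mero_ball:
  assumes "f meromorphic_on UNIV"
  obtains r where "r > 0" "f holomorphic_on ball z r - {z}"
  using mero_isolated[OF assms, of z] unfolding isolated_singularity_at_def
  by (metis analytic_imp_holomorphic)

lemma regular_at_P_analytic:
  assumes nm: "k nicely_meromorphic_on UNIV" and reg: "regular_at_P k"
  shows "\<exists>R. k analytic_on -cball 0 R"
proof -
  obtain H where H: "H analytic_on {0}" "\<forall>\<^sub>F w in at 0. H w = - k (1 / w) / w\<^sup>2"
    using reg by (auto simp: regular_at_P_def)
  obtain e1 where e1: "e1 > 0" "H holomorphic_on ball 0 e1"
    using H(1) by (auto simp: analytic_on_def)
  obtain e2 where e2: "e2 > 0" "\<And>w. w \<noteq> 0 \<Longrightarrow> dist w 0 < e2 \<Longrightarrow> H w = - k (1 / w) / w\<^sup>2"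
    using H(2) unfolding eventually_at by auto
  define e where "e = min e1 e2"
  have e: "e > 0" using e1 e2 by (simp add: e_def)
  let ?S = "-cball 0 (1 / e) :: complex set"
  have inv: "u \<noteq> 0 \<and> norm (1 / u) < e" if "u \<in> ?S" for u
  proof -
    have "1 / e < norm u" using that by simp
    moreover have "1 / e > 0" using e by simp
    ultimately have "norm u > 0" "1 < norm u * e" using e by (auto simp: field_simps)
    thus ?thesis by (auto simp: norm_divide field_simps)
  qed
  have "(\<lambda>u. - H (1 / u) / u\<^sup>2) holomorphic_on ?S"
  proof -
    have "(H \<circ> (\<lambda>u. 1 / u)) holomorphic_on ?S"
      by (rule holomorphic_on_compose_gen[OF _ e1(2)])
        (use inv e1(1) e2(1) in \<open>auto intro!: holomorphic_intros simp: e_def\<close>)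
    thus ?thesis using inv by (auto intro!: holomorphic_intros simp: o_def)
  qed
  moreover have "- H (1 / u) / u\<^sup>2 = k u" if "u \<in> ?S" for u
    using e2(2)[of "1 / u"] inv[OF that] by (simp add: e_def field_simps)
  ultimately have "k holomorphic_on ?S" by (rule holomorphic_transform)
  thus ?thesis by (auto simp: analytic_on_open open_Compl)
qed

lemma remove_sings_add_K_form:
  assumes "K_form f" "K_form g"
  shows "K_form (remove_sings (\<lambda>u. f u + g u))"
proof -
  let ?h = "\<lambda>u. f u + g u"
  have m: "f meromorphic_on UNIV" "g meromorphic_on UNIV"
    using assms by (auto simp: K_form_def nicely_meromorphic_on_def)
  hence h: "?h meromorphic_on UNIV" by (rule meromorphic_on_add)
  have res: "residue (remove_sings ?h) z = 0" for z
  proof -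
    obtain r where r: "r > 0" "f holomorphic_on ball z r - {z}" by (rule mero_ball[OF m(1)])
    obtain s where s: "s > 0" "g holomorphic_on ball z s - {z}" by (rule mero_ball[OF m(2)])
    have "residue ?h z = residue f z + residue g z"
      by (rule residue_add[of "ball z (min r s)"])
        (use r s in \<open>auto intro: holomorphic_on_subset\<close>)
    thus ?thesis using assms by (simp add: K_form_def mero_isolated h)
  qed
  obtain F G where F: "F analytic_on {0}" "\<forall>\<^sub>F w in at 0. F w = - f (1 / w) / w\<^sup>2"
    and G: "G analytic_on {0}" "\<forall>\<^sub>F w in at 0. G w = - g (1 / w) / w\<^sup>2"
    using assms by (auto simp: K_form_def regular_at_P_def)
  have an: "\<forall>\<^sub>F w in at 0. k analytic_on {1 / w}"
    if "k analytic_on -cball 0 R" for k :: "complex \<Rightarrow> complex" and R :: real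
  proof -
    have "\<forall>\<^sub>F w in at (0::complex). w \<in> ball 0 (1 / (\<bar>R\<bar> + 1)) - {0}"
      by (rule eventually_at_in_open) auto
    thus ?thesis
    proof eventually_elim
      case (elim w)
      hence "norm w * (\<bar>R\<bar> + 1) < 1" by (simp add: field_simps)
      hence "\<bar>R\<bar> + 1 < norm (1 / w)" using elim by (simp add: norm_divide field_simps)
      thus ?case using that by (auto intro: analytic_on_subset)
    qed
  qed
  have ra: "\<forall>\<^sub>F w in at 0. remove_sings ?h (1 / w) = ?h (1 / w)"
  proof -
    obtain R S where "f analytic_on -cball 0 R" "g analytic_on -cball 0 S"
      using regular_at_P_analytic assms unfolding K_form_def by meson
    from an[OF this(1)] an[OF this(2)] show ?thesis
      by eventually_elim (simp add: remove_sings_at_analytic analytic_on_add)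
  qed
  have "\<forall>\<^sub>F w in at 0. F w + G w = - remove_sings ?h (1 / w) / w\<^sup>2"
    using F(2) G(2) ra by eventually_elim (simp add: add_divide_distrib diff_divide_distrib)
  hence "regular_at_P (remove_sings ?h)"
    unfolding regular_at_P_def using analytic_on_add[OF F(1) G(1)] by blast
  with res h show ?thesis by (simp add: K_form_def remove_sings_nicely_meromorphic)
qed

lemma cmult_K_form:
  assumes "K_form f"
  shows "K_form (\<lambda>u. c * f u)"
proof -
  have m: "f meromorphic_on UNIV" using assms by (auto simp: K_form_def nicely_meromorphic_on_def)
  have "residue (\<lambda>u. c * f u) z = 0" for z
  proof -
    obtain r where r: "r > 0" "f holomorphic_on ball z r - {z}" by (rule mero_ball[OF m])
    have "residue (\<lambda>u. c * f u) z = c * residue f z"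
      by (rule residue_lmul[of "ball z r"]) (use r in auto)
    thus ?thesis using assms by (simp add: K_form_def)
  qed
  moreover obtain F where F: "F analytic_on {0}" "\<forall>\<^sub>F w in at 0. F w = - f (1 / w) / w\<^sup>2"
    using assms by (auto simp: K_form_def regular_at_P_def)
  have "\<forall>\<^sub>F w in at 0. c * F w = - (c * f (1 / w)) / w\<^sup>2"
    using F(2) by eventually_elim simp
  hence "regular_at_P (\<lambda>u. c * f u)"
    unfolding regular_at_P_def using F(1) by (intro exI[of _ "\<lambda>w. c * F w"] conjI analytic_intros)
  ultimately show ?thesis using assms by (auto simp: K_form_def)
qed

lemma zero_K_form: "K_form (\<lambda>_. 0)"
  unfolding K_form_def regular_at_P_def
  by (auto simp: residue_const intro!: exI[of _ "\<lambda>_. 0"])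

lemma residue_affine_eq_0:
  assumes m: "f meromorphic_on UNIV" and c: "c \<noteq> (0::complex)" and res: "residue f (c * z + d) = 0"
  shows "residue (\<lambda>u. c * f (c * u + d)) z = 0"
proof -
  define y where "y = c * z + d"
  have iso: "isolated_singularity_at f y" and ness: "not_essential f y"
    using m by (simp_all add: meromorphic_on_altdef)
  obtain A h n where A: "open A" "y \<in> A" "h holomorphic_on A"
    "\<And>w. w \<in> A - {y} \<Longrightarrow> f w = h w / (w - y) ^ Suc n"
  proof (cases "is_pole f y")
    case True
    obtain r where r: "r > 0" "f holomorphic_on ball y r - {y}" by (rule mero_ball[OF m])
    from zorder_exist_pole[OF r(2) _ _ True] r(1)
    obtain s where s: "zorder f y < 0" "s > 0" "zor_poly f y holomorphic_on cball y s"
      "\<And>w. w \<in> cball y s - {y} \<Longrightarrow> f w = zor_poly f y w / (w - y) ^ nat (- zorder f y)"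
      by auto
    have "nat (- zorder f y) = Suc (nat (- zorder f y) - 1)" using s(1) by simp
    with s show ?thesis
      by (intro that[of "ball y s" "zor_poly f y" "nat (- zorder f y) - 1"])
        (auto intro: holomorphic_on_subset)
  next
    case False
    let ?h = "remove_sings f"
    have "?h nicely_meromorphic_on UNIV" by (rule remove_sings_nicely_meromorphic[OF m])
    moreover have "\<not> is_pole ?h y"
      using False is_pole_cong[OF eventually_remove_sings_eq_at[OF iso] refl] by simp
    ultimately have "?h analytic_on {y}" by (intro nicely_meromorphic_on_imp_analytic_at) auto
    then obtain e1 where e1: "e1 > 0" "?h holomorphic_on ball y e1" by (auto simp: analytic_on_def)
    obtain e2 where e2: "e2 > 0" "\<And>w. w \<noteq> y \<Longrightarrow> dist w y < e2 \<Longrightarrow> ?h w = f w"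
      using eventually_remove_sings_eq_at[OF iso] unfolding eventually_at by auto
    show ?thesis
    proof (rule that[of "ball y (min e1 e2)" "\<lambda>w. ?h w * (w - y)" 0])
      show "(\<lambda>w. ?h w * (w - y)) holomorphic_on ball y (min e1 e2)"
        by (intro holomorphic_intros holomorphic_on_subset[OF e1(2)]) auto
      show "f w = ?h w * (w - y) / (w - y) ^ Suc 0" if "w \<in> ball y (min e1 e2) - {y}" for w
        using e2(2)[of w] that by (auto simp: dist_commute)
    qed (use e1 e2 in auto)
  qed
  have evA: "\<forall>\<^sub>F w in at y. w \<in> A - {y}" by (rule eventually_at_in_open) (use A in auto)
  have "\<forall>\<^sub>F w in at y. f w = h w / (w - y) ^ Suc n"
    using evA by eventually_elim (rule A(4))
  hence "residue f y = residue (\<lambda>w. h w / (w - y) ^ Suc n) y" by (rule residue_cong) simp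
  also have "\<dots> = (deriv ^^ n) h y / fact n"
    by (rule residue_holomorphic_over_power[OF A(1,2,3)])
  finally have dh: "(deriv ^^ n) h y = 0" using res by (simp add: y_def)
  let ?B = "(\<lambda>u. c * u + d) -` A"
  let ?k = "\<lambda>u. c * h (c * u + d) / c ^ Suc n"
  have B: "open ?B" "z \<in> ?B"
    using A(1,2) by (auto simp: y_def intro!: open_vimage continuous_intros)
  have hol: "(\<lambda>u. h (c * u + d)) holomorphic_on ?B"
  proof -
    have "(h \<circ> (\<lambda>u. c * u + d)) holomorphic_on ?B"
      by (rule holomorphic_on_compose_gen[OF _ A(3)]) (auto intro!: holomorphic_intros)
    thus ?thesis by (simp add: o_def)
  qed
  have evB: "\<forall>\<^sub>F u in at z. u \<in> ?B - {z}" by (rule eventually_at_in_open) (use B in auto)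
  have "\<forall>\<^sub>F u in at z. c * f (c * u + d) = ?k u / (u - z) ^ Suc n"
    using evB
  proof eventually_elim
    case (elim u)
    have "c * u + d - y = c * (u - z)" by (simp add: y_def algebra_simps)
    moreover have "c * u + d \<noteq> y" using elim c by (auto simp: y_def)
    ultimately show ?case
      using A(4)[of "c * u + d"] elim c by (simp add: power_mult_distrib)
  qed
  hence "residue (\<lambda>u. c * f (c * u + d)) z = residue (\<lambda>u. ?k u / (u - z) ^ Suc n) z"
    by (rule residue_cong) simp
  also have "\<dots> = (deriv ^^ n) ?k z / fact n"
    using c by (intro residue_holomorphic_over_power[OF B] holomorphic_intros hol) auto
  also have "(deriv ^^ n) ?k z = (deriv ^^ n) (\<lambda>u. (c / c ^ Suc n) * h (c * u + d)) z"
    by simp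
  also have "\<dots> = (c / c ^ Suc n) * (deriv ^^ n) (\<lambda>u. h (c * u + d)) z"
    by (rule higher_deriv_cmult[OF hol B(2,1)])
  also have "(deriv ^^ n) (\<lambda>u. h (c * u + d)) z = c ^ n * (deriv ^^ n) h (c * z + d)"
    by (rule higher_deriv_compose_linear'[OF A(3) B(1) A(1) B(2)]) auto
  finally show ?thesis using dh by (simp add: y_def)
qed

lemma filtermap_affine_at:
  assumes "c \<noteq> (0::complex)"
  shows "filtermap (\<lambda>u. c * u + d) (at z) = at (c * z + d)"
proof (rule filtermap_fun_inverse)
  show "filterlim (\<lambda>v. (v - d) / c) (at z) (at (c * z + d))"
  proof (rule filterlim_atI)
    have "((\<lambda>v. (v - d) / c) \<longlongrightarrow> (c * z + d - d) / c) (at (c * z + d))"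
      using assms by (intro tendsto_intros) auto
    thus "((\<lambda>v. (v - d) / c) \<longlongrightarrow> z) (at (c * z + d))" using assms by simp
    show "\<forall>\<^sub>F v in at (c * z + d). (v - d) / c \<noteq> z"
      using assms by (auto simp: eventually_at field_simps intro!: exI[of _ 1])
  qed
  show "filterlim (\<lambda>u. c * u + d) (at (c * z + d)) (at z)"
  proof (rule filterlim_atI)
    show "((\<lambda>u. c * u + d) \<longlongrightarrow> c * z + d) (at z)" by (intro tendsto_intros)
    show "\<forall>\<^sub>F u in at z. c * u + d \<noteq> c * z + d"
      using assms by (auto simp: eventually_at intro!: exI[of _ 1])
  qed
  show "\<forall>\<^sub>F v in at (c * z + d). c * ((v - d) / c) + d = v" using assms by simp
qed

lemma affine_K_form:
  assumes "K_form f"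
  shows "K_form (\<lambda>u. c * f (c * u + d))"
proof (cases "c = 0")
  case True
  thus ?thesis using zero_K_form by simp
next
  case c: False
  have nm: "f nicely_meromorphic_on UNIV" and m: "f meromorphic_on UNIV"
    using assms by (auto simp: K_form_def nicely_meromorphic_on_def)
  have "(\<lambda>u. f (c * u + d)) nicely_meromorphic_on UNIV"
    unfolding nicely_meromorphic_on_def
  proof (intro conjI ballI)
    show "(\<lambda>u. f (c * u + d)) meromorphic_on UNIV"
      by (rule meromorphic_on_compose[OF m]) (auto intro!: analytic_intros)
    fix z :: complex
    note fm = filtermap_affine_at[OF c, of d z, symmetric]
    have "is_pole f (c * z + d) \<and> f (c * z + d) = 0 \<or> (f \<longlongrightarrow> f (c * z + d)) (at (c * z + d))"
      using nm by (auto simp: nicely_meromorphic_on_def)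
    thus "is_pole (\<lambda>u. f (c * u + d)) z \<and> f (c * z + d) = 0 \<or>
      ((\<lambda>u. f (c * u + d)) \<longlongrightarrow> f (c * z + d)) (at z)"
      unfolding is_pole_def fm filterlim_filtermap .
  qed
  hence "(\<lambda>u. c * f (c * u + d)) nicely_meromorphic_on UNIV" by (rule nicely_meromorphic_on_cmult_left)
  moreover have "residue (\<lambda>u. c * f (c * u + d)) z = 0" for z
    using assms by (intro residue_affine_eq_0[OF m c]) (simp add: K_form_def)
  moreover have "regular_at_P (\<lambda>u. c * f (c * u + d))"
  proof -
    obtain F where F: "F analytic_on {0}" "\<forall>\<^sub>F w in at 0. F w = - f (1 / w) / w\<^sup>2"
      using assms by (auto simp: K_form_def regular_at_P_def)
    let ?q = "\<lambda>w. w / (c + d * w)"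
    have q: "?q analytic_on {0}" using c by (auto intro!: analytic_intros)
    have "(F \<circ> ?q) analytic_on {0}"
      by (rule analytic_on_compose[OF q]) (use F in simp)
    hence "(\<lambda>w. c * F (?q w) / (c + d * w)\<^sup>2) analytic_on {0}"
      using c by (auto intro!: analytic_intros simp: o_def)
    moreover have nz: "\<forall>\<^sub>F w in at 0. c + d * w \<noteq> 0"
    proof -
      have "((\<lambda>w. c + d * w) \<longlongrightarrow> c + d * 0) (at 0)" by (intro tendsto_intros)
      thus ?thesis using c by (intro tendsto_imp_eventually_ne) auto
    qed
    have w0: "\<forall>\<^sub>F w in at (0::complex). w \<noteq> 0" by (rule eventually_at_ball'[of 1, THEN eventually_mono]) auto
    have "filterlim ?q (at 0) (at 0)"
    proof (rule filterlim_atI)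
      show "(?q \<longlongrightarrow> 0) (at 0)"
        using analytic_at_imp_isCont[OF q] by (simp add: isCont_def)
      show "\<forall>\<^sub>F w in at 0. ?q w \<noteq> 0" using nz w0 by eventually_elim simp
    qed
    from eventually_compose_filterlim[OF F(2) this]
    have "\<forall>\<^sub>F w in at 0. F (?q w) = - f (1 / ?q w) / (?q w)\<^sup>2" .
    hence "\<forall>\<^sub>F w in at 0. c * F (?q w) / (c + d * w)\<^sup>2 = - (c * f (c * (1 / w) + d)) / w\<^sup>2"
      using nz w0
    proof eventually_elim
      case (elim w)
      have "1 / ?q w = c * (1 / w) + d" using elim by (simp add: field_simps)
      with elim show ?case by (simp add: power_divide)
    qed
    ultimately show ?thesis unfolding regular_at_P_def by blast
  qed
  ultimately show ?thesis by (simp add: K_form_def)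
qed

text \<open>The space \<open>\<^bold>K\<close>. Sums are renormalised, since poles may cancel.\<close>

typedef kform = "{f. K_form f}"
  morphisms kcoeff Abs_kform
  using zero_K_form by blast

setup_lifting type_definition_kform

lemma kform_eqI:
  assumes "\<And>z. \<forall>\<^sub>F w in at z. kcoeff a w = kcoeff b w"
  shows "a = b"
  using nicely_meromorphic_eqI[OF _ _ assms] kcoeff[of a] kcoeff[of b]
  by (simp add: K_form_def kcoeff_inject)

instantiation kform :: complex_vector
begin

lift_definition zero_kform :: kform is "\<lambda>_. 0" by (rule zero_K_form)
lift_definition plus_kform :: "kform \<Rightarrow> kform \<Rightarrow> kform" is "\<lambda>f g. remove_sings (\<lambda>u. f u + g u)"
  by (rule remove_sings_add_K_form)
lift_definition cscale_kform :: "complex \<Rightarrow> kform \<Rightarrow> kform" is "\<lambda>c f u. c * f u"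
  by (rule cmult_K_form)
definition uminus_kform :: "kform \<Rightarrow> kform" where "- a = (-1) *\<^sub>C a" for a :: kform
definition minus_kform :: "kform \<Rightarrow> kform \<Rightarrow> kform" where "a - b = a + - b" for a b :: kform

lemma kcoeff_add: "\<forall>\<^sub>F w in at z. kcoeff (a + b) w = kcoeff a w + kcoeff b w"
proof -
  have "(\<lambda>u. kcoeff a u + kcoeff b u) meromorphic_on UNIV"
    using kcoeff[of a] kcoeff[of b]
    by (auto simp: K_form_def nicely_meromorphic_on_def intro: meromorphic_on_add)
  thus ?thesis
    unfolding plus_kform.rep_eq by (intro eventually_remove_sings_eq_at mero_isolated)
qed

instance
proof
  fix a b d :: kform and x y :: complex
  show "a + b + d = a + (b + d)"
  proof (rule kform_eqI)
    fix z
    show "\<forall>\<^sub>F w in at z. kcoeff (a + b + d) w = kcoeff (a + (b + d)) w"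
      using kcoeff_add[of "a + b" d z] kcoeff_add[of a b z] kcoeff_add[of a "b + d" z]
        kcoeff_add[of b d z]
      by eventually_elim (simp add: add.assoc)
  qed
  show "a + b = b + a"
    by transfer (simp add: add.commute)
  show "0 + a = a"
  proof (rule kform_eqI)
    fix z
    show "\<forall>\<^sub>F w in at z. kcoeff (0 + a) w = kcoeff a w"
      using kcoeff_add[of 0 a z] by eventually_elim (simp add: zero_kform.rep_eq)
  qed
  show "- a + a = 0"
  proof (rule kform_eqI)
    fix z
    show "\<forall>\<^sub>F w in at z. kcoeff (- a + a) w = kcoeff 0 w"
      using kcoeff_add[of "- a" a z]
      by eventually_elim (simp add: zero_kform.rep_eq uminus_kform_def cscale_kform.rep_eq)
  qed
  show "a - b = a + - b" by (rule minus_kform_def)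
  show "x *\<^sub>C (a + b) = x *\<^sub>C a + x *\<^sub>C b"
  proof (rule kform_eqI)
    fix z
    show "\<forall>\<^sub>F w in at z. kcoeff (x *\<^sub>C (a + b)) w = kcoeff (x *\<^sub>C a + x *\<^sub>C b) w"
      using kcoeff_add[of a b z] kcoeff_add[of "x *\<^sub>C a" "x *\<^sub>C b" z]
      by eventually_elim (simp add: cscale_kform.rep_eq distrib_left)
  qed
  show "(x + y) *\<^sub>C a = x *\<^sub>C a + y *\<^sub>C a"
  proof (rule kform_eqI)
    fix z
    show "\<forall>\<^sub>F w in at z. kcoeff ((x + y) *\<^sub>C a) w = kcoeff (x *\<^sub>C a + y *\<^sub>C a) w"
      using kcoeff_add[of "x *\<^sub>C a" "y *\<^sub>C a" z]
      by eventually_elim (simp add: cscale_kform.rep_eq distrib_right)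
  qed
  show "x *\<^sub>C (y *\<^sub>C a) = (x * y) *\<^sub>C a" by transfer (simp add: mult.assoc)
  show "1 *\<^sub>C a = a" by transfer simp
qed

end

lemma clinear_kform_map:
  fixes \<phi> :: "kform \<Rightarrow> kform"
  assumes c: "c \<noteq> 0" and \<phi>: "\<And>a. kcoeff (\<phi> a) = (\<lambda>u. c * kcoeff a (c * u + d))"
  shows "clinear \<phi>"
proof -
  have "\<phi> (a + b) = \<phi> a + \<phi> b" for a b
  proof (rule kform_eqI)
    fix z
    have "\<forall>\<^sub>F w in filtermap (\<lambda>u. c * u + d) (at z). kcoeff (a + b) w = kcoeff a w + kcoeff b w"
      unfolding filtermap_affine_at[OF c] by (rule kcoeff_add)
    hence "\<forall>\<^sub>F w in at z. kcoeff (a + b) (c * w + d) = kcoeff a (c * w + d) + kcoeff b (c * w + d)"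
      by (simp add: eventually_filtermap)
    with kcoeff_add[of "\<phi> a" "\<phi> b" z]
    show "\<forall>\<^sub>F w in at z. kcoeff (\<phi> (a + b)) w = kcoeff (\<phi> a + \<phi> b) w"
      by eventually_elim (simp add: \<phi> distrib_left)
  qed
  moreover have "\<phi> (x *\<^sub>C a) = x *\<^sub>C \<phi> a" for x a
    by (simp add: kcoeff_inject[symmetric] \<phi> cscale_kform.rep_eq fun_eq_iff)
  ultimately show ?thesis
    by (simp add: linear_iff_module_hom module_hom_iff cvec.module_axioms)
qed

lift_definition K_shift :: "complex \<Rightarrow> kform \<Rightarrow> kform" is "\<lambda>v f u. f (u - v)"
proof -
  fix v :: complex and f assume "K_form f"
  from affine_K_form[OF this, of 1 "- v"] show "K_form (\<lambda>u. f (u - v))" by simp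
qed

text \<open>
  Pull-back of forms by \<open>\<lambda>\<^sup>-\<^sup>1\<close>, for the rotation \<open>\<lambda>\<close> about \<open>O\<close>; meaningful for \<open>\<lambda> \<noteq> 0\<close>.
\<close>

lift_definition K_rot :: "complex \<Rightarrow> complex \<Rightarrow> kform \<Rightarrow> kform"
  is "\<lambda>Q l f u. f (Q + (u - Q) / l) / l"
proof -
  fix Q l :: complex and f assume "K_form f"
  have "f (Q + (u - Q) / l) / l = 1 / l * f (1 / l * u + (Q - Q / l))" for u
    by (simp add: diff_divide_distrib add_diff_eq add.commute)
  with affine_K_form[OF \<open>K_form f\<close>, of "1 / l" "Q - Q / l"]
  show "K_form (\<lambda>u. f (Q + (u - Q) / l) / l)" by (simp only:)
qed

lemma clinear_K_shift: "clinear (K_shift v)"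
  by (rule clinear_kform_map[of 1 _ "- v"]) (simp_all add: K_shift.rep_eq)

lemma clinear_K_rot: "l \<noteq> 0 \<Longrightarrow> clinear (K_rot Q l)"
  by (rule clinear_kform_map[of "1 / l" _ "Q - Q / l"])
    (simp_all add: K_rot.rep_eq diff_divide_distrib add_diff_eq add.commute)

section \<open>The chiral boson\<close>

type_synonym state = "kform sym"  \<comment> \<open>the space \<open>\<^bold>W = S\<^sup>*\<^bold>K\<close>, with vacuum \<open>1\<close>\<close>

definition K_on :: "complex set \<Rightarrow> kform set" where  \<comment> \<open>\<open>\<^sub>S\<^bold>K\<close>\<close>
  "K_on S = {a. \<forall>z. is_pole (kcoeff a) z \<longrightarrow> z \<in> S}"

definition K_off :: "complex set \<Rightarrow> kform set" where  \<comment> \<open>\<open>\<^bold>K\<^sup>S\<close>\<close>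
  "K_off S = {a. \<forall>z\<in>S. \<not> is_pole (kcoeff a) z}"

definition W_on :: "complex set \<Rightarrow> state set" where "W_on S = symalg (K_on S)"

definition W_off :: "complex set \<Rightarrow> state set" where "W_off S = symalg (K_off S)"

definition W_shift :: "complex \<Rightarrow> state \<Rightarrow> state" where "W_shift v = sym_map (K_shift v)"

definition W_rot :: "complex \<Rightarrow> complex \<Rightarrow> state \<Rightarrow> state" where "W_rot Q l = sym_map (K_rot Q l)"

definition rot :: "complex \<Rightarrow> complex \<Rightarrow> complex \<Rightarrow> complex" where
  "rot Q l z = Q + l * (z - Q)"

text \<open>
  \<open>Y S x v\<close> is the operator \<open>Y(x,v) : \<^bold>W\<^bsup>S+v\<^esup> \<rightarrow> \<^bold>W\<close> attached to a finite set \<open>S\<close>, a state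
  \<open>x \<in> \<^sub>S\<^bold>W\<close> and a translation \<open>v\<close>.  It is a total function in HOL; only its values for such
  arguments and on \<open>\<^bold>W\<^bsup>S+v\<^esup>\<close> matter.  In \<open>complete\<close> the choice of the point \<open>Q\<close> is immaterial, by
  \<open>covariant_shift\<close>.
\<close>

locale vertex_algebra =
  fixes Y :: "complex set \<Rightarrow> state \<Rightarrow> complex \<Rightarrow> state \<Rightarrow> state"
  assumes state_add: "\<lbrakk>finite S; x \<in> W_on S; x' \<in> W_on S; w \<in> W_off ((+) v ` S)\<rbrakk>
      \<Longrightarrow> Y S (x + x') v w = Y S x v w + Y S x' v w"
    and state_scale: "\<lbrakk>finite S; x \<in> W_on S; w \<in> W_off ((+) v ` S)\<rbrakk>
      \<Longrightarrow> Y S (c *\<^sub>C x) v w = c *\<^sub>C Y S x v w"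
    and operator_add: "\<lbrakk>finite S; x \<in> W_on S; w \<in> W_off ((+) v ` S); w' \<in> W_off ((+) v ` S)\<rbrakk>
      \<Longrightarrow> Y S x v (w + w') = Y S x v w + Y S x v w'"
    and operator_scale: "\<lbrakk>finite S; x \<in> W_on S; w \<in> W_off ((+) v ` S)\<rbrakk>
      \<Longrightarrow> Y S x v (c *\<^sub>C w) = c *\<^sub>C Y S x v w"
    and enlarge: "\<lbrakk>finite S'; S \<subseteq> S'; x \<in> W_on S; w \<in> W_off ((+) v ` S')\<rbrakk>
      \<Longrightarrow> Y S' x v w = Y S x v w"
    and locality: "\<lbrakk>finite S; finite S'; x \<in> W_on S; x' \<in> W_on S'; x' \<in> W_off ((+) v ` S)\<rbrakk>
      \<Longrightarrow> Y S x v x' \<in> W_on (S' \<union> (+) v ` S)"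
    and vacuum: "\<lbrakk>finite S; w \<in> W_off ((+) v ` S)\<rbrakk> \<Longrightarrow> Y S 1 v w = w"
    and creation: "\<lbrakk>finite S; x \<in> W_on S\<rbrakk> \<Longrightarrow> Y S x 0 1 = x"
    and commute: "\<lbrakk>finite S; finite S'; x \<in> W_on S; x' \<in> W_on S'; (+) v ` S \<inter> (+) v' ` S' = {};
        w \<in> W_off ((+) v ` S); w \<in> W_off ((+) v' ` S');
        Y S' x' v' w \<in> W_off ((+) v ` S); Y S x v w \<in> W_off ((+) v' ` S')\<rbrakk>
      \<Longrightarrow> Y S x v (Y S' x' v' w) = Y S' x' v' (Y S x v w)"
    and translation: "\<lbrakk>finite S; x \<in> W_on S; w \<in> W_off ((+) (v + v') ` S)\<rbrakk>
      \<Longrightarrow> Y S x (v + v') w = W_shift v' (Y S x v (W_shift (- v') w))"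
    and covariant_shift: "\<lbrakk>finite S; x \<in> W_on S; w \<in> W_off ((+) v ` (+) v' ` S)\<rbrakk>
      \<Longrightarrow> Y ((+) v' ` S) (W_shift v' x) v w = W_shift v' (Y S x v (W_shift (- v') w))"
    and covariant_rot: "\<lbrakk>finite S; x \<in> W_on S; l \<noteq> 0; w \<in> W_off ((+) (l * v) ` rot Q l ` S)\<rbrakk>
      \<Longrightarrow> Y (rot Q l ` S) (W_rot Q l x) (l * v) w = W_rot Q l (Y S x v (W_rot Q (inverse l) w))"
    and complete: "\<exists>Q. cvec.span {foldr (\<lambda>(x, v) w. Y {Q} x v w) xs 1 | xs.
        distinct (map snd xs) \<and> (\<forall>x\<in>fst ` set xs. x \<in> W_on {Q})} = UNIV"

end

theory Submission
  imports Defs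
begin

text \<open>
  The identity is Goddard's uniqueness principle. Let \<open>w\<close> be a state regular on
  \<open>(S\<^sub>1 + v\<^sub>1) \<union> (S\<^sub>2 + v\<^sub>2)\<close>. Only finitely many poles are involved in \<open>w\<close>
  (\<open>W_off_imp_W_on_finite\<close>), so \<open>w\<close> is supported on a finite set \<open>S'\<close> disjoint from both, and
  \<open>w = Y(w,0) 1\<close>. The operator \<open>Y(w,0)\<close> commutes with \<open>Y(x\<^sub>1,v\<^sub>1)\<close>, \<open>Y(x\<^sub>2,v\<^sub>2)\<close> and
  \<open>Y(Y(x\<^sub>1,v\<^sub>1-v\<^sub>2) x\<^sub>2, v\<^sub>2)\<close>, so that it is enough to compare the two sides on the vacuum.
  There \<open>Y(x,v) 1 = T\<^sub>v x\<close> (\<open>Y_vacuum\<close>), and conjugation by \<open>T\<close> turns \<open>Y(x\<^sub>1,v\<^sub>1) T\<^bsub>v\<^sub>2\<^esub> x\<^sub>2\<close> into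
  \<open>T\<^bsub>v\<^sub>2\<^esub> (Y(x\<^sub>1,v\<^sub>1-v\<^sub>2) x\<^sub>2)\<close>.

  Locality guarantees that all these compositions are defined: it confines the poles of
  \<open>Y(x,v) y\<close>, and states supported on a set are regular on any disjoint set.
\<close>

lemma symalg_mono: "U \<subseteq> U' \<Longrightarrow> symalg U \<subseteq> symalg U'"
proof
  fix x assume "U \<subseteq> U'" "x \<in> symalg U"
  from this(2) show "x \<in> symalg U'"
    by induction (use \<open>U \<subseteq> U'\<close> in \<open>auto intro: symalg.intros\<close>)
qed

lemma W_on_mono: "S \<subseteq> S' \<Longrightarrow> W_on S \<subseteq> W_on S'"
  unfolding W_on_def by (intro symalg_mono) (auto simp: K_on_def)

lemma one_in_W_off [simp]: "1 \<in> W_off S"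
  by (simp add: W_off_def symalg_one)

lemma W_on_subset_W_off: "S \<inter> U = {} \<Longrightarrow> W_on S \<subseteq> W_off U"
  unfolding W_on_def W_off_def by (intro symalg_mono) (auto simp: K_on_def K_off_def)

lemma finite_poles_kcoeff: "finite {z. is_pole (kcoeff a) z}"
proof -
  have nm: "kcoeff a nicely_meromorphic_on UNIV" and reg: "regular_at_P (kcoeff a)"
    using kcoeff[of a] by (auto simp: K_form_def)
  obtain R where "kcoeff a analytic_on -cball 0 R"
    using regular_at_P_analytic[OF nm reg] by blast
  hence bounded: "{z. is_pole (kcoeff a) z} \<subseteq> cball 0 R"
    using analytic_at_imp_no_pole analytic_on_analytic_at by blast
  have "\<not> z islimpt {z. is_pole (kcoeff a) z}" for z
    using nm by (intro not_islimpt_poles mero_isolated) (simp add: nicely_meromorphic_on_def)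
  hence "finite (cball 0 R \<inter> {z. is_pole (kcoeff a) z})"
    by (intro finite_not_islimpt_in_compact) auto
  thus ?thesis using bounded by (simp add: Int_absorb1)
qed

text \<open>A state involves finitely many forms, and a form regular at \<open>P\<close> has finitely many poles.\<close>

lemma W_off_imp_W_on_finite:
  assumes "w \<in> W_off U"
  obtains S where "finite S" "S \<inter> U = {}" "w \<in> W_on S"
proof -
  let ?P = "\<lambda>w. \<exists>S. finite S \<and> S \<inter> U = {} \<and> w \<in> W_on S"
  have join: "\<exists>S. finite S \<and> S \<inter> U = {} \<and> x \<in> W_on S \<and> y \<in> W_on S"
    if xy: "?P x" "?P y" for x y
  proof -
    obtain S S' where "finite S" "S \<inter> U = {}" "x \<in> W_on S" "finite S'" "S' \<inter> U = {}" "y \<in> W_on S'"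
      using xy by blast
    thus ?thesis
      using W_on_mono[of S "S \<union> S'"] W_on_mono[of S' "S \<union> S'"]
      by (intro exI[of _ "S \<union> S'"]) auto
  qed
  from assms have "?P w" unfolding W_off_def
  proof induction
    case (symalg_of a)
    let ?S = "{z. is_pole (kcoeff a) z}"
    have "?S \<inter> U = {}" using symalg_of by (auto simp: K_off_def)
    moreover have "sym_of a \<in> W_on ?S"
      unfolding W_on_def by (intro symalg.symalg_of) (simp add: K_on_def)
    ultimately show ?case using finite_poles_kcoeff by blast
  next
    case symalg_one
    have "1 \<in> W_on {}" by (simp add: W_on_def symalg.symalg_one)
    thus ?case by blast
  next
    case (symalg_scale x c)
    thus ?case unfolding W_on_def by (blast intro: symalg.symalg_scale)
  next
    case (symalg_add x y)
    from join[OF symalg_add.IH] show ?case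
      unfolding W_on_def by (blast intro: symalg.symalg_add)
  next
    case (symalg_mult x y)
    from join[OF symalg_mult.IH] show ?case
      unfolding W_on_def by (blast intro: symalg.symalg_mult)
  qed
  thus ?thesis using that by blast
qed

lemma is_pole_K_shift: "is_pole (kcoeff (K_shift v a)) z \<longleftrightarrow> is_pole (kcoeff a) (z - v)"
proof -
  have at_shift: "at (z - v) = filtermap (\<lambda>u. u - v) (at z)"
    using filtermap_affine_at[of 1 "- v" z] by simp
  show ?thesis
    unfolding is_pole_def K_shift.rep_eq at_shift filterlim_filtermap ..
qed

lemma W_shift_in_W_on:
  assumes "x \<in> W_on S"
  shows "W_shift v x \<in> W_on ((+) v ` S)"
  unfolding W_shift_def W_on_def
proof (rule sym_map_symalg[OF clinear_K_shift])
  show "x \<in> symalg (K_on S)" using assms by (simp add: W_on_def)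
  show "K_shift v ` K_on S \<subseteq> K_on ((+) v ` S)"
    by (force simp: K_on_def is_pole_K_shift image_iff)
qed

lemma W_shift_1 [simp]: "W_shift v 1 = 1"
  using calg_hom_sym_map[OF clinear_K_shift] by (simp add: W_shift_def calg_hom_def)

lemma W_shift_inverse [simp]: "W_shift (- v) (W_shift v x) = x"
proof -
  have hom: "calg_hom (W_shift u)" for u
    unfolding W_shift_def by (rule calg_hom_sym_map[OF clinear_K_shift])
  have shift: "K_shift (- v) (K_shift v a) = a" for a
    by transfer simp
  have "x \<in> symalg UNIV" by (simp add: symalg_UNIV)
  from this show ?thesis
    by induction
      (use hom[unfolded W_shift_def] in \<open>auto simp: calg_hom_def W_shift_def sym_map_sym_of clinear_K_shift shift\<close>)
qed

context vertex_algebra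
begin

lemma Y_vacuum:
  assumes "finite S" "x \<in> W_on S"
  shows "Y S x v 1 = W_shift v x"
  using translation[OF assms, of 1 0 v] creation[OF assms] by simp

lemma locality_shifted:
  assumes "finite S" "finite S'" "x \<in> W_on S" "y \<in> W_on S'" "(+) v ` S \<inter> S' = {}"
  shows "Y S x v y \<in> W_on (S' \<union> (+) v ` S)"
proof (rule locality[OF assms(1-4)])
  show "y \<in> W_off ((+) v ` S)" using W_on_subset_W_off[of S' "(+) v ` S"] assms by blast
qed

text \<open>The state \<open>w = Y(w,0) 1\<close> is created from the vacuum and moved past \<open>Y(x,v)\<close>.\<close>

lemma Y_via_creation:
  assumes "finite S" "finite S'" "x \<in> W_on S" "w \<in> W_on S'" "(+) v ` S \<inter> S' = {}"
  shows "Y S x v w = Y S' w 0 (W_shift v x)"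
proof -
  have w: "w \<in> W_off ((+) v ` S)"
    using W_on_subset_W_off[of S' "(+) v ` S"] assms by blast
  have "W_shift v x \<in> W_off S'"
    using W_on_subset_W_off[OF assms(5)] W_shift_in_W_on[OF assms(3)] by blast
  thus ?thesis
    using commute[OF assms(1,2,3,4), of v 0 1] assms(5) w
    by (simp add: creation[OF assms(2,4)] Y_vacuum[OF assms(1,3)])
qed

lemma Y_W_shift:
  assumes "finite S" "x \<in> W_on S" "W_shift u y \<in> W_off ((+) v ` S)"
  shows "Y S x v (W_shift u y) = W_shift u (Y S x (v - u) y)"
  using translation[OF assms(1,2), of "W_shift u y" "v - u" u] assms(3) by simp

end

theorem theorem10p5:
  fixes Y :: "complex set \<Rightarrow> state \<Rightarrow> complex \<Rightarrow> state \<Rightarrow> state"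
    and S\<^sub>1 S\<^sub>2 :: "complex set" and x\<^sub>1 x\<^sub>2 :: state and v\<^sub>1 v\<^sub>2 :: complex
  assumes "vertex_algebra Y"
    and "finite S\<^sub>1" and "finite S\<^sub>2"
    and "x\<^sub>1 \<in> W_on S\<^sub>1" and "x\<^sub>2 \<in> W_on S\<^sub>2"
    and "(+) v\<^sub>1 ` S\<^sub>1 \<inter> (+) v\<^sub>2 ` S\<^sub>2 = {}"
  shows "x\<^sub>2 \<in> W_off ((+) (v\<^sub>1 - v\<^sub>2) ` S\<^sub>1) \<and>
    Y S\<^sub>1 x\<^sub>1 (v\<^sub>1 - v\<^sub>2) x\<^sub>2 \<in> W_on (S\<^sub>2 \<union> (+) (v\<^sub>1 - v\<^sub>2) ` S\<^sub>1) \<and>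
    (\<forall>w \<in> W_off ((+) v\<^sub>1 ` S\<^sub>1 \<union> (+) v\<^sub>2 ` S\<^sub>2).
      Y S\<^sub>2 x\<^sub>2 v\<^sub>2 w \<in> W_off ((+) v\<^sub>1 ` S\<^sub>1) \<and>
      Y S\<^sub>1 x\<^sub>1 v\<^sub>1 (Y S\<^sub>2 x\<^sub>2 v\<^sub>2 w) =
        Y (S\<^sub>2 \<union> (+) (v\<^sub>1 - v\<^sub>2) ` S\<^sub>1) (Y S\<^sub>1 x\<^sub>1 (v\<^sub>1 - v\<^sub>2) x\<^sub>2) v\<^sub>2 w)"
proof -
  interpret vertex_algebra Y by fact
  note fin = assms(2,3) and on = assms(4,5) and disj = assms(6)
  let ?T1 = "(+) v\<^sub>1 ` S\<^sub>1" and ?T2 = "(+) v\<^sub>2 ` S\<^sub>2"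
  let ?S = "S\<^sub>2 \<union> (+) (v\<^sub>1 - v\<^sub>2) ` S\<^sub>1"
  let ?x = "Y S\<^sub>1 x\<^sub>1 (v\<^sub>1 - v\<^sub>2) x\<^sub>2"
  have shift: "(+) v\<^sub>2 ` (+) (v\<^sub>1 - v\<^sub>2) ` S\<^sub>1 = ?T1"
    by (simp add: image_image)
  hence disj': "(+) (v\<^sub>1 - v\<^sub>2) ` S\<^sub>1 \<inter> S\<^sub>2 = {}"
    using disj by blast
  hence x2: "x\<^sub>2 \<in> W_off ((+) (v\<^sub>1 - v\<^sub>2) ` S\<^sub>1)"
    using W_on_subset_W_off[of S\<^sub>2] on(2) by blast
  have x: "?x \<in> W_on ?S"
    by (rule locality_shifted[OF fin on disj'])
  have "Y S\<^sub>2 x\<^sub>2 v\<^sub>2 w \<in> W_off ?T1 \<and> Y S\<^sub>1 x\<^sub>1 v\<^sub>1 (Y S\<^sub>2 x\<^sub>2 v\<^sub>2 w) = Y ?S ?x v\<^sub>2 w"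
    if "w \<in> W_off (?T1 \<union> ?T2)" for w
  proof -
    obtain S' where S': "finite S'" "S' \<inter> (?T1 \<union> ?T2) = {}" and w: "w \<in> W_on S'"
      using \<open>w \<in> W_off (?T1 \<union> ?T2)\<close> by (rule W_off_imp_W_on_finite)
    have d1: "?T1 \<inter> S' = {}" and d2: "?T2 \<inter> S' = {}" and d: "(+) v\<^sub>2 ` ?S \<inter> S' = {}"
      using S'(2) by (auto simp: image_Un shift)
    let ?y = "W_shift v\<^sub>2 x\<^sub>2"
    have y: "?y \<in> W_on ?T2" by (rule W_shift_in_W_on[OF on(2)])
    have y_off: "?y \<in> W_off ?T1" "?y \<in> W_off S'"
      using y W_on_subset_W_off[of ?T2] disj d2 by blast+
    have Yw: "Y S\<^sub>2 x\<^sub>2 v\<^sub>2 w = Y S' w 0 ?y"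
      by (rule Y_via_creation[OF fin(2) S'(1) on(2) w d2])
    have Yw_off: "Y S\<^sub>2 x\<^sub>2 v\<^sub>2 w \<in> W_off ?T1"
      using locality_shifted[OF fin(2) S'(1) on(2) w d2]
        W_on_subset_W_off[of "S' \<union> ?T2" ?T1] d1 disj by blast
    have "Y S\<^sub>1 x\<^sub>1 v\<^sub>1 ?y \<in> W_on (?T2 \<union> ?T1)"
      using fin on(1) y disj by (intro locality_shifted) auto
    hence Yy_off: "Y S\<^sub>1 x\<^sub>1 v\<^sub>1 ?y \<in> W_off S'"
      using W_on_subset_W_off[of "?T2 \<union> ?T1" S'] d1 d2 by blast
    have "Y S\<^sub>1 x\<^sub>1 v\<^sub>1 (Y S\<^sub>2 x\<^sub>2 v\<^sub>2 w) = Y S' w 0 (Y S\<^sub>1 x\<^sub>1 v\<^sub>1 ?y)"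
      using commute[OF fin(1) S'(1) on(1) w, of v\<^sub>1 0 ?y] d1 y_off Yw_off Yy_off
      by (simp add: Yw)
    also have "\<dots> = Y S' w 0 (W_shift v\<^sub>2 ?x)"
      by (simp add: Y_W_shift[OF fin(1) on(1) y_off(1)])
    also have "\<dots> = Y ?S ?x v\<^sub>2 w"
      using fin by (intro Y_via_creation[OF _ S'(1) x w d, symmetric]) simp
    finally show ?thesis using Yw_off by blast
  qed
  with x2 x show ?thesis by blast
qed

end
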